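(* Let $f:\mathbb R\to[0,\infty)$ be continuous, compactly supported and of bounded variation. Then $$\mathbf{ucat}(f)=M(f)$$ (both sides possibly $\infty$). Moreover, if $M(f)=n<\infty$, then an explicit minimal unimodal decomposition $(u_i)_{i=1}^n$ of $f$ (i.e. unimodal functions $u_1,\dots,u_n$ with $f=\sum_{i=1}^n u_i$, where $n=\mathbf{ucat}(f)$) is obtained as follows. Extend $f$ to $\overline{\mathbb R}=[-\infty,\infty]$ by $f(\pm\infty)=0$ and define $g,h:\overline{\mathbb R}\to[0,\infty)$ by $$g(x)=V^+(f;(-\infty,x]),\qquad h(x)=V^-(f;(-\infty,x]).$$ Recursively define $(x_i)_{i=0}^{n+1}$ by $x_0=-\infty$, $$x_i=\inf\{x\mid V^-(f;(x_{i-1},x))>f(x_{i-1})\},\qquad i=1,\dots,n,$$ and $x_{n+1}=\infty$. Finally, for $i=1,\dots,n$ define $u_i:\mathbb R\to[0,\infty)$ by $$u_i(x)=\begin{cases}0, & x\le x_{i-1},\\ g(x)-g(x_{i-1}), & x\in[x_{i-1},x_i],\\ h(x_{i+1})-h(x), & x\in[x_i,x_{i+1}],\\ 0, & x\ge x_{i+1}.\end{cases}$$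
   Context: A continuous function $u:X\to[0,\infty)$ on a topological space is unimodal if there is $M>0$ such that the superlevel set $u^{-1}[c,\infty)$ is contractible for $0<c\le M$ and empty for $c>M$. The unimodal category $\mathbf{ucat}(f)$ of $f:X\to[0,\infty)$ is the minimum number $n$ of unimodal functions $u_1,\dots,u_n:X\to[0,\infty)$ with $f=\sum_{i=1}^n u_i$ pointwise ($\infty$ if there is no such $n$; the empty sum is $0$). For an interval $I\subseteq\mathbb R$, $V^+(f;I)=\sup\sum_{i=1}^k\max\{0,f(t_i)-f(t_{i-1})\}$, $V^-(f;I)=\sup\sum_{i=1}^k\max\{0,f(t_{i-1})-f(t_i)\}$ and $V(f;I)=\sup\sum_{i=1}^k|f(t_i)-f(t_{i-1})|$, with suprema over all finite sequences $t_0<t_1<\dots<t_k$ of points of $I$. "Bounded variation" means $V(f;\mathbb R)<\infty$. The interval arguments for $x=\pm\infty$ are interpreted in the obvious way: $g(-\infty)=h(-\infty)=0$, $g(\infty)=V^+(f;\mathbb R)$, $h(\infty)=V^-(f;\mathbb R)$. An open interval $(x,y)$ with $-\infty\le x<y\le\infty$ is forced-max with respect to $f$ if $V^-(f;(x,y))>f(x)$ (where $f(-\infty)=0$). $M(f)$ is the maximum number of pairwise disjoint open intervals that are forced-max with respect to $f$ ($\infty$ if there is no finite bound). Conventions: $\inf\emptyset=\infty$ and $(a,b)=\emptyset$ if $a\ge b$. *)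

theory Defs
  imports "HOL-Analysis.Analysis"
begin

text \<open>The library counts the empty set as \<^const>\<open>contractible\<close>; the usual topological notion
  (homotopy equivalent to a point) does not, so nonemptiness is required separately.\<close>

definition unimodal :: "('a::topological_space \<Rightarrow> real) \<Rightarrow> bool" where
  "unimodal u \<longleftrightarrow> continuous_on UNIV u \<and> (\<forall>x. 0 \<le> u x) \<and>
     (\<exists>M>0. (\<forall>c. 0 < c \<and> c \<le> M \<longrightarrow> u -` {c..} \<noteq> {} \<and> contractible (u -` {c..})) \<and>
            (\<forall>c>M. u -` {c..} = {}))"

definition unimodal_decomposition ::
    "('a::topological_space \<Rightarrow> real) \<Rightarrow> nat \<Rightarrow> (nat \<Rightarrow> 'a \<Rightarrow> real) \<Rightarrow> bool" where
  "unimodal_decomposition f n u \<longleftrightarrow>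
     (\<forall>i\<in>{1..n}. unimodal (u i)) \<and> (\<forall>x. f x = (\<Sum>i=1..n. u i x))"

definition ucat :: "('a::topological_space \<Rightarrow> real) \<Rightarrow> enat" where
  "ucat f = Inf {enat n | n. \<exists>u. unimodal_decomposition f n u}"

text \<open>A pair \<open>(k, t)\<close> encodes a finite sequence \<open>t 0 < \<dots> < t k\<close> of points of \<open>I\<close>. Suprema are taken
  in \<^typ>\<open>ennreal\<close>, so that all variations over the empty set are 0.\<close>

definition increasing_seqs :: "real set \<Rightarrow> (nat \<times> (nat \<Rightarrow> real)) set" where
  "increasing_seqs I = {(k, t). strict_mono_on {..k} t \<and> t ` {..k} \<subseteq> I}"

definition pos_var :: "(real \<Rightarrow> real) \<Rightarrow> real set \<Rightarrow> ennreal" where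
  "pos_var f I = (SUP (k, t) \<in> increasing_seqs I.
     ennreal (\<Sum>i=1..k. max 0 (f (t i) - f (t (i - 1)))))"

definition neg_var :: "(real \<Rightarrow> real) \<Rightarrow> real set \<Rightarrow> ennreal" where
  "neg_var f I = (SUP (k, t) \<in> increasing_seqs I.
     ennreal (\<Sum>i=1..k. max 0 (f (t (i - 1)) - f (t i))))"

definition total_var :: "(real \<Rightarrow> real) \<Rightarrow> real set \<Rightarrow> ennreal" where
  "total_var f I = (SUP (k, t) \<in> increasing_seqs I.
     ennreal (\<Sum>i=1..k. \<bar>f (t i) - f (t (i - 1))\<bar>))"

definition extend0 :: "(real \<Rightarrow> real) \<Rightarrow> ereal \<Rightarrow> real" where
  "extend0 f x = (if \<bar>x\<bar> = \<infinity> then 0 else f (real_of_ereal x))"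

definition forced_max :: "(real \<Rightarrow> real) \<Rightarrow> ereal \<Rightarrow> ereal \<Rightarrow> bool" where
  "forced_max f x y \<longleftrightarrow> x < y \<and> neg_var f (einterval x y) > ennreal (extend0 f x)"

text \<open>An open interval is represented by its pair of endpoints. This is faithful because
  forced-max intervals are nonempty.\<close>

definition max_forced :: "(real \<Rightarrow> real) \<Rightarrow> enat" where
  "max_forced f = Sup {enat (card A) | A. finite A \<and> (\<forall>(x, y)\<in>A. forced_max f x y) \<and>
     disjoint_family_on (\<lambda>(x, y). einterval x y) A}"

text \<open>The functions \<open>g\<close> and \<open>h\<close>. They are only used for \<open>f\<close> of bounded variation, where the
  variations are finite and \<^const>\<open>enn2real\<close> loses nothing.\<close>

definition cum_pos :: "(real \<Rightarrow> real) \<Rightarrow> ereal \<Rightarrow> real" where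
  "cum_pos f x = enn2real (pos_var f {t. ereal t \<le> x})"

definition cum_neg :: "(real \<Rightarrow> real) \<Rightarrow> ereal \<Rightarrow> real" where
  "cum_neg f x = enn2real (neg_var f {t. ereal t \<le> x})"

text \<open>The breakpoints \<open>x\<^sub>0, \<dots>, x\<^sub>n\<^sub>+\<^sub>1\<close>. In \<^typ>\<open>ereal\<close>, the infimum of the empty set is \<open>\<infinity>\<close>.\<close>

primrec breakpoint :: "(real \<Rightarrow> real) \<Rightarrow> nat \<Rightarrow> nat \<Rightarrow> ereal" where
  "breakpoint f n 0 = -\<infinity>"
| "breakpoint f n (Suc i) =
     (if Suc i \<le> n
      then Inf {x. neg_var f (einterval (breakpoint f n i) x) > ennreal (extend0 f (breakpoint f n i))}
      else \<infinity>)"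

text \<open>The branches of the piecewise definition overlap at the breakpoints; here the first applicable
  one is taken. \<open>pieces_agree\<close> states that every applicable branch gives the same value.\<close>

definition piece :: "(real \<Rightarrow> real) \<Rightarrow> nat \<Rightarrow> nat \<Rightarrow> real \<Rightarrow> real" where
  "piece f n i x =
     (if ereal x \<le> breakpoint f n (i - 1) then 0
      else if ereal x \<le> breakpoint f n i
        then cum_pos f (ereal x) - cum_pos f (breakpoint f n (i - 1))
      else if ereal x \<le> breakpoint f n (i + 1)
        then cum_neg f (breakpoint f n (i + 1)) - cum_neg f (ereal x)
      else 0)"

definition pieces_agree :: "(real \<Rightarrow> real) \<Rightarrow> nat \<Rightarrow> bool" where
  "pieces_agree f n \<longleftrightarrow> (\<forall>i\<in>{1..n}. \<forall>x.
     (ereal x \<le> breakpoint f n (i - 1) \<longrightarrow> piece f n i x = 0) \<and>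
     (breakpoint f n (i - 1) \<le> ereal x \<and> ereal x \<le> breakpoint f n i \<longrightarrow>
        piece f n i x = cum_pos f (ereal x) - cum_pos f (breakpoint f n (i - 1))) \<and>
     (breakpoint f n i \<le> ereal x \<and> ereal x \<le> breakpoint f n (i + 1) \<longrightarrow>
        piece f n i x = cum_neg f (breakpoint f n (i + 1)) - cum_neg f (ereal x)) \<and>
     (breakpoint f n (i + 1) \<le> ereal x \<longrightarrow> piece f n i x = 0))"

end

theory Submission
  imports Defs
begin

text \<open>
  The cumulative variations \<open>g = cum_pos f\<close> and \<open>h = cum_neg f\<close> are continuous and nondecreasing on the
  extended line, start at 0, and satisfy \<open>f = g - h\<close>; because \<open>f\<close> vanishes at infinity, they end at
  the same value \<open>T\<close>. So \<open>[h x, g x]\<close> is a window of length \<open>f x\<close> whose two ends travel monotonically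
  from 0 to \<open>T\<close>. Since \<open>neg_var f (x, y) = h y - h x\<close>, the interval \<open>(x, y)\<close> is forced-max iff
  \<open>h y > g x\<close>, that is, iff at time \<open>y\<close> the window has moved strictly past its position at time \<open>x\<close>.

  Cut \<open>[0, T]\<close> at the levels \<open>a\<^sub>i = g x\<^sub>i\<close> given by the breakpoints. Their recursive definition says
  \<open>h x\<^sub>i = g x\<^sub>i\<^sub>-\<^sub>1\<close>, so at time \<open>x\<^sub>i\<close> the window is exactly the slab \<open>[a\<^sub>i\<^sub>-\<^sub>1, a\<^sub>i]\<close>. The function \<open>u\<^sub>i x\<close> is
  the length of the part of the window at time \<open>x\<close> that lies in this slab: it grows while the upper
  end crosses the slab, shrinks while the lower end does, and is therefore unimodal with peak at
  \<open>x\<^sub>i\<close>. The slabs tile \<open>[0, T]\<close>, so the \<open>u\<^sub>i\<close> add up to the length \<open>f\<close> of the window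
  (\<open>sum_slice\<close>, \<open>unimodal_slice\<close>).

  Conversely, in any unimodal decomposition of \<open>f\<close> every forced-max interval contains a peak of a
  summand: over an interval without its peak, a unimodal function is either nonincreasing or
  nondecreasing, so its total drop is at most its starting value. If no summand had its peak in the
  interval, then \<open>f\<close> could drop by at most its own starting value. Hence \<open>max_forced f \<le> ucat f\<close>
  (\<open>max_forced_le_ucat\<close>).

  Finally, as long as the \<open>(i+1)\<close>-st cut is possible, i.e. \<open>g x\<^sub>i < T\<close>, there are \<open>i + 1\<close> disjoint
  forced-max intervals, obtained by moving the cuts slightly to the right
  (\<open>disjoint_intervals_if_cut_less\<close>). If the cutting stops after \<open>n\<close> steps, then
  \<open>n \<le> max_forced f \<le> ucat f \<le> n\<close>; if it never stops, both quantities are infinite.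
\<close>

section \<open>Variation along finite sequences\<close>

text \<open>The negative variation along a finite sequence given as a list. Lists make concatenation, splitting
  at a point and insertion of points easier than sequences indexed by an initial segment.\<close>

fun drops :: "(real \<Rightarrow> real) \<Rightarrow> real list \<Rightarrow> real" where
  "drops f (x # y # zs) = max 0 (f x - f y) + drops f (y # zs)"
| "drops f _ = 0"

lemma drops_nonneg: "0 \<le> drops f xs"
  by (induction f xs rule: drops.induct) auto

lemma drops_append: "drops f (xs @ c # ys) = drops f (xs @ [c]) + drops f (c # ys)"
proof (induction xs)
  case (Cons x xs)
  then show ?case by (cases xs) auto
qed simp

text \<open>The negative part satisfies the triangle inequality, so refining a sequence can only increase its
  variation.\<close>

lemma drops_insert: "drops f (xs @ ys) \<le> drops f (xs @ c # ys)"
proof (induction xs)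
  case Nil
  show ?case by (cases ys) auto
next
  case (Cons x xs)
  show ?case
  proof (cases xs)
    case Nil
    then show ?thesis by (cases ys) (auto simp: max_def)
  next
    case (Cons a list)
    then show ?thesis using Cons.IH by simp
  qed
qed

lemma drops_split: "drops f (xs @ ys) \<le> drops f (xs @ [c]) + drops f (c # ys)"
  using drops_insert[of f xs ys c] drops_append[of f xs c ys] by simp

lemma drops_map_upt:
  "drops f (map t [0..<Suc k]) = (\<Sum>i=1..k. max 0 (f (t (i - 1)) - f (t i)))"
proof (induction k)
  case (Suc k)
  have "map t [0..<Suc (Suc k)] = map t [0..<k] @ t k # [t (Suc k)]"
    by simp
  then have "drops f (map t [0..<Suc (Suc k)])
      = drops f (map t [0..<Suc k]) + max 0 (f (t k) - f (t (Suc k)))"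
    using drops_append[of f "map t [0..<k]" "t k" "[t (Suc k)]"] by simp
  then show ?case using Suc by simp
qed simp

text \<open>The empty list is admitted on the right. Its value 0 does not change the supremum, and it makes the
  index set nonempty even for empty \<open>I\<close>.\<close>

lemma neg_var_eq_SUP_drops:
  "neg_var f I = (SUP xs \<in> {xs. sorted_wrt (<) xs \<and> set xs \<subseteq> I}. ennreal (drops f xs))"
  (is "_ = (SUP xs \<in> ?L. _)")
proof (rule antisym)
  show "neg_var f I \<le> (SUP xs \<in> ?L. ennreal (drops f xs))"
    unfolding neg_var_def
  proof (rule SUP_least, clarify)
    fix k t assume "(k, t) \<in> increasing_seqs I"
    then have t: "strict_mono_on {..k} t" "t ` {..k} \<subseteq> I"
      by (auto simp: increasing_seqs_def)
    let ?xs = "map t [0..<Suc k]"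
    have "sorted_wrt (<) ?xs"
      using t(1) by (auto simp: sorted_wrt_iff_nth_less strict_mono_on_def simp del: upt_Suc)
    moreover have "set ?xs \<subseteq> I"
      using t(2) by (auto simp del: upt_Suc)
    ultimately have "?xs \<in> ?L" by blast
    then show "ennreal (\<Sum>i=1..k. max 0 (f (t (i - 1)) - f (t i))) \<le> (SUP xs \<in> ?L. ennreal (drops f xs))"
      unfolding drops_map_upt[symmetric] by (rule SUP_upper)
  qed
next
  show "(SUP xs \<in> ?L. ennreal (drops f xs)) \<le> neg_var f I"
  proof (rule SUP_least, clarify)
    fix xs :: "real list" assume xs: "sorted_wrt (<) xs" "set xs \<subseteq> I"
    show "ennreal (drops f xs) \<le> neg_var f I"
    proof (cases "xs = []")
      case False
      then obtain k where k: "length xs = Suc k" by (cases xs) auto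
      have "strict_mono_on {..k} (nth xs)"
        using xs(1) k by (auto simp: strict_mono_on_def sorted_wrt_iff_nth_less)
      moreover have "nth xs ` {..k} \<subseteq> I"
        using xs(2) k by (auto simp: subset_iff less_Suc_eq_le)
      ultimately have "(k, nth xs) \<in> increasing_seqs I"
        by (simp add: increasing_seqs_def)
      moreover have "drops f xs = (\<Sum>i=1..k. max 0 (f (xs ! (i - 1)) - f (xs ! i)))"
        using drops_map_upt[of f "nth xs" k] k map_nth[of xs] by simp
      ultimately show ?thesis
        unfolding neg_var_def by (intro SUP_upper2[of "(k, nth xs)"]) auto
    qed simp
  qed
qed

lemma drops_le_neg_var:
  "sorted_wrt (<) xs \<Longrightarrow> set xs \<subseteq> I \<Longrightarrow> ennreal (drops f xs) \<le> neg_var f I"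
  unfolding neg_var_eq_SUP_drops by (rule SUP_upper) simp

lemma neg_var_leI:
  "(\<And>xs. sorted_wrt (<) xs \<Longrightarrow> set xs \<subseteq> I \<Longrightarrow> ennreal (drops f xs) \<le> B) \<Longrightarrow> neg_var f I \<le> B"
  unfolding neg_var_eq_SUP_drops by (rule SUP_least) simp

lemma less_neg_varE:
  assumes "B < neg_var f I"
  obtains xs where "sorted_wrt (<) xs" "set xs \<subseteq> I" "B < ennreal (drops f xs)"
  using assms unfolding neg_var_eq_SUP_drops less_SUP_iff by auto

lemma neg_var_mono: "I \<subseteq> J \<Longrightarrow> neg_var f I \<le> neg_var f J"
  by (rule neg_var_leI) (auto intro: drops_le_neg_var)

lemma neg_var_empty [simp]: "neg_var f {} = 0"
  by (simp add: neg_var_eq_SUP_drops cong: conj_cong)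

text \<open>This turns every fact about negative variation into one about positive variation.\<close>

lemma pos_var_eq_neg_var: "pos_var f I = neg_var (\<lambda>x. - f x) I"
  by (simp add: pos_var_def neg_var_def)

lemma neg_var_le_total_var: "neg_var f I \<le> total_var f I"
  unfolding neg_var_def total_var_def
  by (intro SUP_mono) (auto intro!: bexI ennreal_leI sum_mono)

lemma total_var_uminus: "total_var (\<lambda>x. - f x) I = total_var f I"
  by (simp add: total_var_def abs_minus_commute algebra_simps)

text \<open>Both halves of a split are to end, respectively start, at \<open>c\<close>. The two cases \<open>c \<in> set xs\<close> and
  \<open>c \<notin> set xs\<close> are kept in one equation because the list must remain strictly sorted when \<open>c\<close> is
  inserted.\<close>

lemma strictly_sorted_split_at:
  fixes c :: "'a :: linorder"
  assumes "sorted_wrt (<) xs"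
  shows "xs = filter (\<lambda>x. x < c) xs @ (if c \<in> set xs then [c] else []) @ filter (\<lambda>x. c < x) xs"
  using assms
proof (induction xs)
  case (Cons a xs)
  consider "a < c" | "a = c" | "c < a" by force
  then show ?case
  proof cases
    case 3
    then have *: "x \<in> set xs \<Longrightarrow> c < x" for x using Cons.prems by auto
    then have "filter (\<lambda>x. x < c) xs = []" "filter (\<lambda>x. c < x) xs = xs" "c \<notin> set xs"
      by (auto simp: filter_empty_conv filter_id_conv dest: *)
    with 3 show ?thesis by auto
  next
    case 2
    then have *: "x \<in> set xs \<Longrightarrow> c < x" for x using Cons.prems by auto
    then have "filter (\<lambda>x. x < c) xs = []" "filter (\<lambda>x. c < x) xs = xs" "c \<notin> set xs"
      by (auto simp: filter_empty_conv filter_id_conv dest: *)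
    with 2 show ?thesis by auto
  qed (use Cons in auto)
qed simp

text \<open>A sequence in \<open>I\<close> may be refined by \<open>c\<close> and then falls into a part on each side of \<open>c\<close>; conversely,
  sequences on the two sides can be glued at \<open>c\<close>.\<close>

lemma neg_var_split:
  assumes "c \<in> I"
  shows "neg_var f I = neg_var f (I \<inter> {..c}) + neg_var f (I \<inter> {c..})"
proof (rule antisym)
  let ?low = "filter (\<lambda>x. x < c)" and ?up = "filter (\<lambda>x. c < x)"
  show "neg_var f I \<le> neg_var f (I \<inter> {..c}) + neg_var f (I \<inter> {c..})"
  proof (rule neg_var_leI)
    fix xs assume xs: "sorted_wrt (<) xs" "set xs \<subseteq> I"
    have "drops f xs \<le> drops f (?low xs @ [c]) + drops f (c # ?up xs)"
      using strictly_sorted_split_at[OF xs(1), of c] drops_split[of f "?low xs" "?up xs" c]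
        drops_append[of f "?low xs" c "?up xs"] by (metis append_Cons append_Nil order_refl)
    then have "ennreal (drops f xs) \<le> ennreal (drops f (?low xs @ [c])) + ennreal (drops f (c # ?up xs))"
      by (simp add: ennreal_leI drops_nonneg flip: ennreal_plus)
    also have "\<dots> \<le> neg_var f (I \<inter> {..c}) + neg_var f (I \<inter> {c..})"
      using xs assms
      by (intro add_mono drops_le_neg_var) (auto simp: sorted_wrt_append sorted_wrt_filter)
    finally show "ennreal (drops f xs) \<le> neg_var f (I \<inter> {..c}) + neg_var f (I \<inter> {c..})" .
  qed
  \<comment> \<open>Points equal to \<open>c\<close> are dropped from both lists and then put back once.\<close>
  have glue: "ennreal (drops f xs) + ennreal (drops f ys) \<le> neg_var f I"
    if xs: "sorted_wrt (<) xs" "set xs \<subseteq> I \<inter> {..c}"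
      and ys: "sorted_wrt (<) ys" "set ys \<subseteq> I \<inter> {c..}" for xs ys
  proof -
    have "?up xs = []" "?low ys = []"
      using xs ys by (fastforce simp: filter_empty_conv)+
    then have "drops f xs \<le> drops f (?low xs @ [c])" "drops f ys \<le> drops f (c # ?up ys)"
      using strictly_sorted_split_at[OF xs(1), of c] strictly_sorted_split_at[OF ys(1), of c]
        drops_insert[of f "?low xs" "[]" c] drops_insert[of f "[]" "?up ys" c]
      by (smt (verit) append_Nil append_Nil2 append_Cons)+
    then have "drops f xs + drops f ys \<le> drops f (?low xs @ c # ?up ys)"
      using drops_append[of f "?low xs" c "?up ys"] by linarith
    then have "ennreal (drops f xs) + ennreal (drops f ys) \<le> ennreal (drops f (?low xs @ c # ?up ys))"
      by (simp add: ennreal_leI drops_nonneg flip: ennreal_plus)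
    also have "\<dots> \<le> neg_var f I"
      using xs ys assms
      by (intro drops_le_neg_var) (auto simp: sorted_wrt_append sorted_wrt_filter)
    finally show ?thesis .
  qed
  let ?L = "\<lambda>J. {xs. sorted_wrt (<) xs \<and> set xs \<subseteq> J}"
  have ne: "?L J \<noteq> {}" for J :: "real set" by (auto intro!: exI[of _ "[]"])
  have "ennreal (drops f xs) + neg_var f (I \<inter> {c..}) \<le> neg_var f I"
    if "sorted_wrt (<) xs" "set xs \<subseteq> I \<inter> {..c}" for xs
    unfolding neg_var_eq_SUP_drops[of f "I \<inter> {c..}"] ennreal_SUP_add_right[OF ne]
    using glue[OF that] by (intro SUP_least) blast
  then show "neg_var f (I \<inter> {..c}) + neg_var f (I \<inter> {c..}) \<le> neg_var f I"
    unfolding neg_var_eq_SUP_drops[of f "I \<inter> {..c}"] ennreal_SUP_add_left[OF ne, symmetric]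
    by (intro SUP_least) blast
qed

text \<open>Every point of a sequence in the closure is a limit of points of \<open>I\<close>. Moving all points
  simultaneously keeps their order eventually and, by continuity, moves the variation only
  slightly. This one fact yields both the passage between open and closed intervals and the
  continuity of the cumulative variations.\<close>

lemma neg_var_closure:
  assumes "continuous_on UNIV f"
  shows "neg_var f (closure I) = neg_var f I"
proof (rule antisym)
  show "neg_var f (closure I) \<le> neg_var f I"
  proof (rule neg_var_leI)
    fix xs assume xs: "sorted_wrt (<) xs" "set xs \<subseteq> closure I"
    \<comment> \<open>\<open>s x\<close> is a sequence in \<open>I\<close> that converges to \<open>x\<close>.\<close>
    have "\<exists>s. x \<in> closure I \<longrightarrow> (\<forall>n. s n \<in> I) \<and> s \<longlonglongrightarrow> x" for x
      by (meson closure_sequential)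
    then obtain s where s: "\<And>x n. x \<in> closure I \<Longrightarrow> s x n \<in> I" "\<And>x. x \<in> closure I \<Longrightarrow> s x \<longlonglongrightarrow> x"
      by metis
    have f: "(\<lambda>n. f (s x n)) \<longlonglongrightarrow> f x" if "x \<in> closure I" for x
      using s(2)[OF that] assms continuous_on_tendsto_compose[of UNIV f "s x" x] by auto
    have lim: "(\<lambda>n. drops f (map (\<lambda>x. s x n) xs)) \<longlonglongrightarrow> drops f xs"
      using xs(2) by (induction xs rule: induct_list012) (auto intro!: tendsto_intros f)
    have ev: "\<forall>\<^sub>F n in sequentially. sorted_wrt (<) (map (\<lambda>x. s x n) xs)"
      using xs
    proof (induction xs)
      case (Cons x xs)
      have "\<forall>\<^sub>F n in sequentially. \<forall>y\<in>set xs. s x n < s y n"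
      proof (intro eventually_ball_finite ballI)
        fix y assume "y \<in> set xs"
        then have "x < y" "x \<in> closure I" "y \<in> closure I" using Cons.prems by auto
        then have *: "((\<lambda>n. s y n - s x n) \<longlongrightarrow> y - x) sequentially" "0 < y - x"
          by (auto intro!: tendsto_intros s)
        show "\<forall>\<^sub>F n in sequentially. s x n < s y n"
          using order_tendstoD(1)[OF *] by eventually_elim simp
      qed simp
      then show ?case
        using Cons by (auto elim: eventually_elim2)
    qed simp
    have "\<forall>\<^sub>F n in sequentially. ennreal (drops f (map (\<lambda>x. s x n) xs)) \<le> neg_var f I"
      using ev by eventually_elim (rule drops_le_neg_var, use xs s in auto)
    then show "ennreal (drops f xs) \<le> neg_var f I"
      using lim by (intro tendsto_upperbound[of "\<lambda>n. ennreal (drops f (map (\<lambda>x. s x n) xs))"])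
        (auto intro!: tendsto_ennrealI)
  qed
qed (intro neg_var_mono closure_subset)

text \<open>Rises minus falls telescope to the net change along the sequence.\<close>

lemma drops_uminus:
  "xs \<noteq> [] \<Longrightarrow> drops (\<lambda>x. - f x) xs = drops f xs + f (last xs) - f (hd xs)"
  by (induction xs rule: induct_list012) auto

section \<open>Cumulative variations on the extended line\<close>

text \<open>Stated pointwise so that infinite endpoints need no separate treatment.\<close>

lemma einterval_subset_closure:
  assumes "x < y" "x \<le> ereal t" "ereal t \<le> y"
  shows "t \<in> closure (einterval x y)"
  unfolding closure_approachable
proof (intro allI impI)
  fix e :: real assume "0 < e"
  have "max x (ereal (t - e)) < min y (ereal (t + e))"
  proof -
    have "ereal (t - e) < ereal t" "ereal t < ereal (t + e)" using \<open>0 < e\<close> by auto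
    moreover from this have "x < ereal (t + e)" "ereal (t - e) < y"
      using le_less_trans[OF assms(2)] less_le_trans[OF _ assms(3)] by blast+
    ultimately show ?thesis using assms(1) by simp
  qed
  then obtain s where s: "max x (ereal (t - e)) < ereal s" "ereal s < min y (ereal (t + e))"
    using ereal_dense2 by blast
  then have "s \<in> einterval x y" "dist s t < e"
    by (auto simp: einterval_iff dist_real_def)
  then show "\<exists>s\<in>einterval x y. dist s t < e" by blast
qed

text \<open>Additivity at \<open>x\<close>, with the right part over the open interval, in which forced-max intervals are
  phrased; removing the endpoints is harmless by \<open>neg_var_closure\<close>.\<close>

lemma neg_var_atMost_split:
  assumes "continuous_on UNIV f" "x \<le> y"
  shows "neg_var f {t. ereal t \<le> y} = neg_var f {t. ereal t \<le> x} + neg_var f (einterval x y)"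
proof (cases "x < y")
  case False
  with assms have "x = y" by simp
  then have "einterval x y = {}" by (auto simp: einterval_iff)
  with \<open>x = y\<close> show ?thesis by simp
next
  case True
  let ?B = "{t. x \<le> ereal t \<and> ereal t \<le> y}"
  have "neg_var f ?B \<le> neg_var f (closure (einterval x y))"
    using einterval_subset_closure[OF True] by (intro neg_var_mono) blast
  also have "\<dots> = neg_var f (einterval x y)" by (rule neg_var_closure[OF assms(1)])
  finally have "neg_var f ?B \<le> neg_var f (einterval x y)" .
  moreover have "neg_var f (einterval x y) \<le> neg_var f ?B"
    by (rule neg_var_mono) (auto simp: einterval_iff)
  ultimately have B: "neg_var f ?B = neg_var f (einterval x y)" by (rule antisym)
  show ?thesis
  proof (cases x)
    case (real r)
    have "{t. ereal t \<le> y} \<inter> {..r} = {t. ereal t \<le> x}" "{t. ereal t \<le> y} \<inter> {r..} = ?B"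
      using True real by (auto intro: order.trans[of _ "ereal r"])
    then show ?thesis using neg_var_split[of r "{t. ereal t \<le> y}" f] True real B by simp
  next
    case PInf
    with True show ?thesis by simp
  next
    case MInf
    with B show ?thesis by simp
  qed
qed

locale continuous_bv =
  fixes f :: "real \<Rightarrow> real"
  assumes cont: "continuous_on UNIV f" and bv: "total_var f UNIV < \<infinity>"
begin

lemma continuous_bv_uminus: "continuous_bv (\<lambda>x. - f x)"
  using cont bv by unfold_locales (auto simp: total_var_uminus intro: continuous_on_minus)

lemma neg_var_finite: "neg_var f I < \<infinity>"
  using neg_var_mono[of I UNIV f] neg_var_le_total_var[of f UNIV] bv by (meson order_le_less_trans subset_UNIV)

lemma ennreal_cum_neg: "ennreal (cum_neg f x) = neg_var f {t. ereal t \<le> x}"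
  unfolding cum_neg_def using neg_var_finite by simp

lemma cum_neg_nonneg: "0 \<le> cum_neg f x"
  by (simp add: cum_neg_def)

lemma cum_neg_MInf: "cum_neg f (-\<infinity>) = 0"
  by (simp add: cum_neg_def)

lemma neg_var_einterval:
  assumes "x \<le> y"
  shows "neg_var f (einterval x y) = ennreal (cum_neg f y - cum_neg f x)"
proof -
  have "ennreal (cum_neg f y) = ennreal (cum_neg f x) + neg_var f (einterval x y)"
    unfolding ennreal_cum_neg by (rule neg_var_atMost_split[OF cont assms])
  then show ?thesis
    using cum_neg_nonneg[of x] by (metis ennreal_add_diff_cancel_left ennreal_minus ennreal_neq_top)
qed

lemma cum_neg_mono: "x \<le> y \<Longrightarrow> cum_neg f x \<le> cum_neg f y"
  unfolding cum_neg_def using neg_var_finite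
  by (intro enn2real_mono neg_var_mono) (auto intro: order.trans)

lemma drops_le_cum_neg:
  assumes "x \<le> y" "sorted_wrt (<) xs" "set xs \<subseteq> einterval x y"
  shows "drops f xs \<le> cum_neg f y - cum_neg f x"
  using drops_le_neg_var[OF assms(2,3), of f] neg_var_einterval[OF assms(1)] cum_neg_mono[OF assms(1)]
  by (simp add: ennreal_le_iff)

lemma cum_neg_approx_drops:
  assumes "x \<le> y" "c < cum_neg f y - cum_neg f x"
  obtains xs where "sorted_wrt (<) xs" "set xs \<subseteq> einterval x y" "c < drops f xs"
proof (cases "c < 0")
  case True
  then show ?thesis using that[of "[]"] by simp
next
  case False
  then have "ennreal c < neg_var f (einterval x y)"
    using assms(2) neg_var_einterval[OF assms(1)] by (simp add: ennreal_less_iff)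
  then show ?thesis
    using False that by (auto elim!: less_neg_varE simp: ennreal_less_iff)
qed

text \<open>A finite sequence in \<open>(-\<infinity>, x)\<close> already lies in \<open>(-\<infinity>, z)\<close> for some \<open>z < x\<close>. So the supremum that
  defines the cumulative variation at \<open>x\<close> is almost attained to the left of \<open>x\<close>.\<close>

lemma cum_neg_approx_left:
  assumes "-\<infinity> < x" "c < cum_neg f x"
  shows "\<exists>z<x. c < cum_neg f z"
proof (cases "c < 0")
  case True
  with assms show ?thesis using cum_neg_nonneg[of "-\<infinity>"] by (intro exI[of _ "-\<infinity>"]) auto
next
  case False
  have "-\<infinity> \<le> x" "c < cum_neg f x - cum_neg f (-\<infinity>)"
    using assms by (simp_all add: cum_neg_MInf)
  then obtain xs where xs: "sorted_wrt (<) xs" "set xs \<subseteq> einterval (-\<infinity>) x" "c < drops f xs"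
    by (rule cum_neg_approx_drops)
  with False have ne: "set xs \<noteq> {}" by auto
  then have "Max (set xs) \<in> einterval (-\<infinity>) x" using xs(2) by (meson List.finite_set Max_in subsetD)
  then obtain z where z: "ereal (Max (set xs)) < z" "z < x"
    using dense by (auto simp: einterval_iff)
  have "set xs \<subseteq> einterval (-\<infinity>) z"
  proof
    fix t assume "t \<in> set xs"
    then have "ereal t \<le> ereal (Max (set xs))" by simp
    with z(1) show "t \<in> einterval (-\<infinity>) z" unfolding einterval_iff by (metis ereal_infty_less(2) le_less_trans PInfty_neq_ereal(1) MInfty_neq_ereal(2))
  qed
  then have "c < cum_neg f z"
    using drops_le_cum_neg[OF _ xs(1), of "-\<infinity>" z] xs(3) by (simp add: cum_neg_MInf)
  with z(2) show ?thesis by blast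
qed

text \<open>The mirror image of the preceding argument, applied to the variation over \<open>(x, \<infinity>)\<close>, which is what
  remains of the total variation at \<open>x\<close>.\<close>

lemma cum_neg_approx_right:
  assumes "x < \<infinity>" "cum_neg f x < c"
  shows "\<exists>z>x. cum_neg f z < c"
proof (cases "cum_neg f \<infinity> < c")
  case True
  with assms show ?thesis by blast
next
  case False
  have "x \<le> \<infinity>" "cum_neg f \<infinity> - c < cum_neg f \<infinity> - cum_neg f x"
    using assms by simp_all
  then obtain xs where xs: "sorted_wrt (<) xs" "set xs \<subseteq> einterval x \<infinity>" "cum_neg f \<infinity> - c < drops f xs"
    by (rule cum_neg_approx_drops)
  with False have ne: "set xs \<noteq> {}" by auto
  then have "Min (set xs) \<in> einterval x \<infinity>" using xs(2) by (meson List.finite_set Min_in subsetD)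
  then obtain z where z: "x < z" "z < ereal (Min (set xs))"
    using dense by (auto simp: einterval_iff)
  have "set xs \<subseteq> einterval z \<infinity>"
  proof
    fix t assume "t \<in> set xs"
    then have "ereal (Min (set xs)) \<le> ereal t" by simp
    with z(2) show "t \<in> einterval z \<infinity>" unfolding einterval_iff
      by (metis less_ereal.simps(4) less_ereal.simps(2) order_less_le_trans ereal_less_PInfty ereal_infty_less(1) PInfty_neq_ereal(1))
  qed
  then have "cum_neg f z < c"
    using drops_le_cum_neg[OF _ xs(1), of z \<infinity>] xs(3) by simp
  with z(1) show ?thesis by blast
qed

text \<open>Continuity holds on the whole extended line, including the two infinite points; the
  breakpoints are infima in the extended reals, so this is the form needed later.\<close>

lemma continuous_cum_neg: "continuous_on UNIV (cum_neg f)"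
proof -
  have "(cum_neg f \<longlongrightarrow> cum_neg f x) (at x)" for x
  proof (rule order_tendstoI)
    fix c assume c: "c < cum_neg f x"
    show "\<forall>\<^sub>F y in at x. c < cum_neg f y"
    proof (cases "x = -\<infinity>")
      case True
      then have "c < cum_neg f y" for y using c cum_neg_mono[of x y] by simp
      then show ?thesis by simp
    next
      case False
      then obtain z where z: "z < x" "c < cum_neg f z" using cum_neg_approx_left c by auto
      have "\<forall>\<^sub>F y in at x. z < y" by (rule order_tendstoD(1)[OF tendsto_ident_at z(1)])
      then show ?thesis by eventually_elim (meson z(2) cum_neg_mono less_imp_le order_less_le_trans)
    qed
  next
    fix c assume c: "cum_neg f x < c"
    show "\<forall>\<^sub>F y in at x. cum_neg f y < c"
    proof (cases "x = \<infinity>")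
      case True
      then have "cum_neg f y < c" for y using c cum_neg_mono[of y x] by simp
      then show ?thesis by simp
    next
      case False
      then obtain z where z: "x < z" "cum_neg f z < c" using cum_neg_approx_right c by auto
      have "\<forall>\<^sub>F y in at x. y < z" by (rule order_tendstoD(2)[OF tendsto_ident_at z(1)])
      then show ?thesis by eventually_elim (meson z(2) cum_neg_mono less_imp_le order_le_less_trans)
    qed
  qed
  then show ?thesis by (simp add: continuous_on_def)
qed

lemma cum_pos_eq: "cum_pos f = cum_neg (\<lambda>x. - f x)"
  by (simp add: cum_pos_def cum_neg_def pos_var_eq_neg_var fun_eq_iff)

end

text \<open>One half of \<open>g - h = f\<close>, namely \<open>g \<le> h + f\<close>. The other half is the same inequality for \<open>- f\<close>, which is
  why \<open>f\<close> may take negative values here. A given sequence is extended to start at a point \<open>s\<close> left of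
  the support and to end at \<open>x\<close> (or right of the support if \<open>x = \<infinity>\<close>). This does not decrease its
  rises, and afterwards rises minus falls equal \<open>f e - f s = f x\<close>.\<close>

lemma (in continuous_bv) cum_neg_uminus_le:
  assumes supp: "\<And>t. f t \<noteq> 0 \<Longrightarrow> a \<le> t \<and> t \<le> b"
  shows "cum_neg (\<lambda>t. - f t) x \<le> cum_neg f x + extend0 f x"
proof (cases "x = -\<infinity>")
  case True
  then show ?thesis by (simp add: cum_neg_def extend0_def)
next
  case False
  have bound: "drops (\<lambda>t. - f t) xs \<le> cum_neg f x + extend0 f x"
    if xs: "sorted_wrt (<) xs" "set xs \<subseteq> {t. ereal t \<le> x}" for xs
  proof -
    obtain e where e: "ereal e \<le> x" "f e = extend0 f x" "\<forall>t\<in>set xs. t \<le> e"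
    proof (cases x)
      case (real r)
      then show ?thesis using that[of r] xs(2) by (auto simp: extend0_def)
    next
      case PInf
      define m where "m = Max (insert b (set xs)) + 1"
      have m: "t < m" if "t \<in> insert b (set xs)" for t
      proof -
        have "t \<le> Max (insert b (set xs))" using that by (intro Max_ge) auto
        then show ?thesis by (simp add: m_def)
      qed
      have "f m = 0" using supp[of m] m[of b] by fastforce
      then show ?thesis using m PInf by (intro that[of m]) (auto simp: extend0_def less_imp_le)
    qed (use False in simp)
    define s where "s = Min (insert a (insert e (set xs))) - 1"
    have s: "s < t" if "t \<in> insert a (insert e (set xs))" for t
    proof -
      have "Min (insert a (insert e (set xs))) \<le> t" using that by (intro Min_le) auto
      then show ?thesis by (simp add: s_def)
    qed
    have "f s = 0" using supp[of s] s[of a] by fastforce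
    let ?L = "filter (\<lambda>t. t < e) xs"
    have up: "filter (\<lambda>t. e < t) xs = []" using e(3) by (force simp: filter_empty_conv)
    have "drops (\<lambda>t. - f t) xs \<le> drops (\<lambda>t. - f t) (?L @ [e])"
    proof (cases "e \<in> set xs")
      case True
      then have "xs = ?L @ [e]" using strictly_sorted_split_at[OF xs(1), of e] up by simp
      then show ?thesis by (metis order_refl)
    next
      case False
      then have "xs = ?L" using strictly_sorted_split_at[OF xs(1), of e] up by simp
      then show ?thesis using drops_insert[of "\<lambda>t. - f t" ?L "[]" e] by (metis append_Nil2)
    qed
    also have "\<dots> \<le> drops (\<lambda>t. - f t) (s # ?L @ [e])"
      using drops_insert[of "\<lambda>t. - f t" "[]" "?L @ [e]" s] by simp
    also have "\<dots> = drops f (s # ?L @ [e]) + f e"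
      using drops_uminus[of "s # ?L @ [e]" f] \<open>f s = 0\<close> by simp
    also have "\<dots> \<le> cum_neg f x + extend0 f x"
    proof -
      have "ereal s \<le> x" using s[of e] e(1) by (auto intro: order.trans[of _ "ereal e"])
      then have "ennreal (drops f (s # ?L @ [e])) \<le> neg_var f {t. ereal t \<le> x}"
        using xs s e(1) by (intro drops_le_neg_var) (auto simp: sorted_wrt_append sorted_wrt_filter)
      then show ?thesis
        using e(2) cum_neg_nonneg by (simp flip: ennreal_cum_neg)
    qed
    finally show ?thesis .
  qed
  have "0 \<le> cum_neg f x + extend0 f x" using bound[of "[]"] by simp
  moreover have "neg_var (\<lambda>t. - f t) {t. ereal t \<le> x} \<le> ennreal (cum_neg f x + extend0 f x)"
    by (intro neg_var_leI ennreal_leI bound)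
  ultimately show ?thesis
    unfolding cum_neg_def[of "\<lambda>t. - f t"] by (rule enn2real_leI)
qed

section \<open>Unimodal functions on the line\<close>

lemma unimodalI_peak:
  fixes u :: "real \<Rightarrow> real"
  assumes "continuous_on UNIV u" "\<And>x. 0 \<le> u x" "0 < u p"
    and incr: "\<And>x y. x \<le> y \<Longrightarrow> y \<le> p \<Longrightarrow> u x \<le> u y"
    and decr: "\<And>x y. p \<le> x \<Longrightarrow> x \<le> y \<Longrightarrow> u y \<le> u x"
  shows "unimodal u"
  unfolding unimodal_def
proof (intro conjI exI[of _ "u p"] allI impI)
  fix c assume c: "0 < c \<and> c \<le> u p"
  then show "u -` {c..} \<noteq> {}" by auto
  have "is_interval (u -` {c..})"
    unfolding is_interval_1
  proof (intro ballI allI impI)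
    fix a b x assume "a \<in> u -` {c..}" "b \<in> u -` {c..}" "a \<le> x \<and> x \<le> b"
    then have "c \<le> u x" using incr[of a x] decr[of x b] by (cases "x \<le> p") auto
    then show "x \<in> u -` {c..}" by simp
  qed
  then show "contractible (u -` {c..})"
    by (intro convex_imp_contractible) (simp add: is_interval_convex_1)
next
  fix c assume "u p < c"
  moreover have "u x \<le> u p" for x using incr[of x p] decr[of p x] by (cases "x \<le> p") auto
  ultimately have "u x < c" for x by (rule le_less_trans[rotated])
  then show "u -` {c..} = {}" by (auto simp: set_eq_iff not_le)
qed (rule assms(1-3))+

text \<open>Contractible subsets of the line are intervals, so a unimodal function is quasi-concave. The value
  \<open>M\<close> is attained because the superlevel set at \<open>M\<close> itself is nonempty; any point of it serves as the
  peak.\<close>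

lemma unimodal_peakE:
  fixes u :: "real \<Rightarrow> real"
  assumes "unimodal u"
  obtains p where "\<And>x y. x \<le> y \<Longrightarrow> y \<le> p \<Longrightarrow> u x \<le> u y"
    and "\<And>x y. p \<le> x \<Longrightarrow> x \<le> y \<Longrightarrow> u y \<le> u x"
proof -
  from assms obtain M where M: "M > 0"
      "\<And>c. 0 < c \<Longrightarrow> c \<le> M \<Longrightarrow> u -` {c..} \<noteq> {} \<and> contractible (u -` {c..})"
      "\<And>c. c > M \<Longrightarrow> u -` {c..} = {}"
    and nonneg: "\<And>x. 0 \<le> u x"
    unfolding unimodal_def by blast
  obtain p where p: "M \<le> u p" using M(1) M(2)[of M] by auto
  have le_M: "u x \<le> M" for x
  proof (rule ccontr)
    assume "\<not> u x \<le> M"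
    then have "u -` {u x..} = {}" by (intro M(3)) simp
    then show False by blast
  qed
  have between: "min (u a) (u b) \<le> u x" if "a \<le> x" "x \<le> b" for a b x
  proof (cases "min (u a) (u b) = 0")
    case False
    let ?c = "min (u a) (u b)"
    have "0 < ?c" "?c \<le> M" using False nonneg[of a] nonneg[of b] le_M[of a] by auto
    then have "is_interval (u -` {?c..})"
      using M(2)[of ?c] contractible_imp_connected is_interval_connected_1 by blast
    moreover have "a \<in> u -` {?c..}" "b \<in> u -` {?c..}" by auto
    ultimately have "x \<in> u -` {?c..}" using that unfolding is_interval_1 by blast
    then show ?thesis by simp
  qed (use nonneg in simp)
  show ?thesis
  proof (rule that[of p])
    show "u x \<le> u y" if "x \<le> y" "y \<le> p" for x y
      using between[OF that] p le_M[of x] by simp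
    show "u y \<le> u x" if "p \<le> x" "x \<le> y" for x y
      using between[OF that] p le_M[of y] by simp
  qed
qed

section \<open>Peaks in forced-max intervals\<close>

lemma drops_sum_le: "drops (\<lambda>x. \<Sum>i\<in>I. u i x) xs \<le> (\<Sum>i\<in>I. drops (u i) xs)"
proof (induction xs rule: induct_list012)
  case (3 x y zs)
  have "(\<Sum>i\<in>I. u i x) - (\<Sum>i\<in>I. u i y) \<le> (\<Sum>i\<in>I. max 0 (u i x - u i y))"
    unfolding sum_subtractf[symmetric] by (rule sum_mono) simp
  moreover have "0 \<le> (\<Sum>i\<in>I. max 0 (u i x - u i y))"
    by (rule sum_nonneg) simp
  ultimately show ?case using 3 by (simp add: sum.distrib)
qed simp_all

lemma drops_increasing: "sorted_wrt (\<lambda>x y. u x \<le> u y) xs \<Longrightarrow> drops u xs = 0"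
  by (induction xs rule: induct_list012) auto

lemma drops_decreasing:
  "sorted_wrt (\<lambda>x y. u y \<le> u x) xs \<Longrightarrow> xs \<noteq> [] \<Longrightarrow> drops u xs = u (hd xs) - u (last xs)"
  by (induction xs rule: induct_list012) auto

text \<open>The peak lies to the right of the interval, where \<open>u\<close> then never drops, or to the left, where \<open>u\<close>
  then only falls, and by at most its starting value since it stays nonnegative. A left endpoint
  \<open>-\<infinity>\<close> always falls under the first case.\<close>

lemma drops_le_start_if_no_peak:
  assumes incr: "\<And>x y. x \<le> y \<Longrightarrow> y \<le> p \<Longrightarrow> u x \<le> u y"
    and decr: "\<And>x y. p \<le> x \<Longrightarrow> x \<le> y \<Longrightarrow> u y \<le> u x"
    and nonneg: "\<And>x. 0 \<le> u x"
    and no_peak: "p \<notin> einterval x y"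
    and xs: "sorted_wrt (<) xs" "set xs \<subseteq> einterval x y"
  shows "drops u xs \<le> extend0 u x"
proof (cases "xs = []")
  case True
  then show ?thesis using nonneg by (simp add: extend0_def)
next
  case False
  from no_peak consider "y \<le> ereal p" | "ereal p \<le> x" by (force simp: einterval_iff not_less)
  then show ?thesis
  proof cases
    case 1
    have "sorted_wrt (\<lambda>s t. u s \<le> u t) xs"
    proof (rule sorted_wrt_mono_rel[OF _ xs(1)])
      fix s t assume "s \<in> set xs" "t \<in> set xs" "s < t"
      then have "ereal t < y" using xs(2) by (auto simp: einterval_iff)
      with 1 have "ereal t < ereal p" by (rule order_less_le_trans[rotated])
      with \<open>s < t\<close> show "u s \<le> u t" by (intro incr) auto
    qed
    then show ?thesis using drops_increasing nonneg by (simp add: extend0_def)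
  next
    case 2
    have gt: "x < ereal t" if "t \<in> set xs" for t using that xs(2) by (auto simp: einterval_iff)
    then obtain r where r: "x = ereal r" using 2 False gt[of "hd xs"] by (cases x) auto
    have "sorted_wrt (\<lambda>s t. u t \<le> u s) xs"
    proof (rule sorted_wrt_mono_rel[OF _ xs(1)])
      fix s t assume "s \<in> set xs" "t \<in> set xs" "s < t"
      then show "u t \<le> u s" using gt[of s] 2 r by (intro decr) auto
    qed
    then have "drops u xs \<le> u (hd xs)" using drops_decreasing[of u xs] False nonneg[of "last xs"] by simp
    also have "\<dots> \<le> u r" using gt[of "hd xs"] False 2 r by (intro decr) auto
    finally show ?thesis using r by (simp add: extend0_def)
  qed
qed

text \<open>Assign to each forced-max interval a summand whose peak it contains. Disjointness makes this
  assignment injective.\<close>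

lemma card_forced_le_unimodal_decomposition:
  assumes dec: "unimodal_decomposition f n u"
    and forced: "\<And>x y. (x, y) \<in> A \<Longrightarrow> forced_max f x y"
    and disj: "disjoint_family_on (\<lambda>(x, y). einterval x y) A"
  shows "card A \<le> n"
proof -
  have uni: "\<And>i. i \<in> {1..n} \<Longrightarrow> unimodal (u i)" and f_eq: "f = (\<lambda>x. \<Sum>i=1..n. u i x)"
    using dec by (auto simp: unimodal_decomposition_def)
  have nonneg: "\<And>i x. i \<in> {1..n} \<Longrightarrow> 0 \<le> u i x" using uni by (simp add: unimodal_def)
  have "\<exists>p. (\<forall>x y. x \<le> y \<longrightarrow> y \<le> p \<longrightarrow> u i x \<le> u i y) \<and> (\<forall>x y. p \<le> x \<longrightarrow> x \<le> y \<longrightarrow> u i y \<le> u i x)"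
    if "i \<in> {1..n}" for i
    using unimodal_peakE[OF uni[OF that]] by metis
  then obtain p where incr: "\<And>i x y. i \<in> {1..n} \<Longrightarrow> x \<le> y \<Longrightarrow> y \<le> p i \<Longrightarrow> u i x \<le> u i y"
    and decr: "\<And>i x y. i \<in> {1..n} \<Longrightarrow> p i \<le> x \<Longrightarrow> x \<le> y \<Longrightarrow> u i y \<le> u i x"
    by metis
  have "\<exists>i\<in>{1..n}. p i \<in> einterval x y" if xy: "(x, y) \<in> A" for x y
  proof (rule ccontr)
    assume no_peak: "\<not> (\<exists>i\<in>{1..n}. p i \<in> einterval x y)"
    have "neg_var f (einterval x y) \<le> ennreal (extend0 f x)"
    proof (rule neg_var_leI, rule ennreal_leI)
      fix xs assume xs: "sorted_wrt (<) xs" "set xs \<subseteq> einterval x y"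
      have "drops f xs \<le> (\<Sum>i=1..n. drops (u i) xs)"
        unfolding f_eq by (rule drops_sum_le)
      also have "\<dots> \<le> (\<Sum>i=1..n. extend0 (u i) x)"
        using no_peak xs
        by (intro sum_mono drops_le_start_if_no_peak[of "p _"] incr decr nonneg) auto
      also have "\<dots> = extend0 f x"
        by (simp add: extend0_def f_eq)
      finally show "drops f xs \<le> extend0 f x" .
    qed
    with forced[OF xy] show False by (auto simp: forced_max_def dest: leD)
  qed
  then have "\<forall>I\<in>A. \<exists>i\<in>{1..n}. p i \<in> (\<lambda>(x, y). einterval x y) I" by auto
  then obtain m where m: "\<And>I. I \<in> A \<Longrightarrow> m I \<in> {1..n}"
      "\<And>I. I \<in> A \<Longrightarrow> p (m I) \<in> (\<lambda>(x, y). einterval x y) I"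
    by metis
  have "inj_on m A"
  proof (rule inj_onI, rule ccontr)
    fix I J assume "I \<in> A" "J \<in> A" "m I = m J" "I \<noteq> J"
    then show False using m(2)[of I] m(2)[of J] disjoint_family_onD[OF disj, of I J] by auto
  qed
  then have "card A \<le> card {1..n}" using m(1) by (intro card_inj_on_le) auto
  then show ?thesis by simp
qed

lemma max_forced_le_ucat: "max_forced f \<le> ucat f"
  unfolding max_forced_def ucat_def
  by (rule Sup_least, rule Inf_greatest) (auto intro!: card_forced_le_unimodal_decomposition)

section \<open>Slicing a sliding window\<close>

lemma continuous_ereal_less_right:
  fixes \<phi> :: "ereal \<Rightarrow> real"
  assumes "continuous_on UNIV \<phi>" "x < \<infinity>" "\<phi> x < c"
  obtains z where "x < z" "\<phi> z < c"
proof -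
  have "open (\<phi> -` {..<c})" using assms(1) by (simp add: open_vimage)
  then obtain b where "x < b" "{x..<b} \<subseteq> \<phi> -` {..<c}"
    using open_right[of "\<phi> -` {..<c}" x \<infinity>] assms by auto
  moreover obtain z where "x < z" "z < b" using dense[OF \<open>x < b\<close>] by blast
  ultimately have "\<phi> z < c" by (auto simp: subset_iff)
  with \<open>x < z\<close> show ?thesis by (rule that)
qed

lemma continuous_ereal_greater_left:
  fixes \<phi> :: "ereal \<Rightarrow> real"
  assumes "continuous_on UNIV \<phi>" "-\<infinity> < x" "c < \<phi> x"
  obtains z where "z < x" "c < \<phi> z"
proof -
  have "open (\<phi> -` {c<..})" using assms(1) by (simp add: open_vimage)
  then obtain b where "b < x" "{b<..x} \<subseteq> \<phi> -` {c<..}"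
    using open_left[of "\<phi> -` {c<..}" x "-\<infinity>"] assms by auto
  moreover obtain z where "b < z" "z < x" using dense[OF \<open>b < x\<close>] by blast
  ultimately have "c < \<phi> z" by (auto simp: subset_iff)
  with \<open>z < x\<close> show ?thesis by (rule that)
qed

text \<open>The window \<open>[h x, g x]\<close>. All that the greedy construction uses of the two cumulative
  variations is collected here; the function \<open>f\<close> is recovered as the length \<open>g x - h x\<close>.\<close>

locale sliding_window =
  fixes g h :: "ereal \<Rightarrow> real"
  assumes g_mono: "x \<le> y \<Longrightarrow> g x \<le> g y" and h_mono: "x \<le> y \<Longrightarrow> h x \<le> h y"
    and g_cont: "continuous_on UNIV g" and h_cont: "continuous_on UNIV h"
    and h_le_g: "h x \<le> g x"
    and g_MInf: "g (-\<infinity>) = 0" and h_MInf: "h (-\<infinity>) = 0" and h_PInf: "h \<infinity> = g \<infinity>"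
begin

text \<open>The breakpoints for an unlimited number of steps. The next cut is where the lower end of the window
  reaches the level at which the upper end stood at the previous cut.\<close>

primrec cut :: "nat \<Rightarrow> ereal" where
  "cut 0 = -\<infinity>"
| "cut (Suc i) = Inf {x. g (cut i) < h x}"

lemma h_nonneg: "0 \<le> h x"
  using h_mono[of "-\<infinity>" x] h_MInf by simp

lemma g_nonneg: "0 \<le> g x"
  using h_nonneg h_le_g by (rule order_trans)

lemma less_if_g_less_h: "g x < h y \<Longrightarrow> x < y"
  using h_le_g[of x] h_mono[of y x] by (meson not_less order_le_less_trans order_less_le_trans)

text \<open>At the time \<open>cut (Suc i)\<close> the window therefore fills exactly the slab between two consecutive levels.
  The infimum alone gives only values of \<open>h\<close> near the level;
  continuity from both sides gives equality.\<close>

lemma h_cut: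
  assumes "g (cut i) < h \<infinity>"
  shows "h (cut (Suc i)) = g (cut i)"
proof (rule antisym; rule leI; rule notI)
  assume less: "g (cut i) < h (cut (Suc i))"
  then have "-\<infinity> < cut (Suc i)"
    using g_nonneg[of "cut i"] h_MInf by (cases "cut (Suc i)") auto
  then obtain z where "z < cut (Suc i)" "g (cut i) < h z"
    using continuous_ereal_greater_left[OF h_cont _ less] by blast
  moreover from this(2) have "cut (Suc i) \<le> z" by (simp add: Inf_lower)
  ultimately show False by simp
next
  assume less: "h (cut (Suc i)) < g (cut i)"
  then have "cut (Suc i) < \<infinity>" using assms by (cases "cut (Suc i)") auto
  then obtain z where z: "cut (Suc i) < z" "h z < g (cut i)"
    using continuous_ereal_less_right[OF h_cont _ less] by blast
  then obtain w where "g (cut i) < h w" "w < z" by (auto simp: Inf_less_iff)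
  then show False using z(2) h_mono[of w z] by (meson less_asym less_imp_le order_less_le_trans)
qed

lemma cut_le_Suc: "cut i \<le> cut (Suc i)"
  unfolding cut.simps by (rule Inf_greatest) (auto dest: less_if_g_less_h)

text \<open>A level repeated once is repeated forever, because a cut depends only on the level before it. So a
  construction that ever reaches the top level never stalls before. (A stall can occur for
  functions oscillating infinitely often right after a zero, and then the construction goes on
  without end.)\<close>

lemma g_cut_strict:
  assumes "g (cut i) < h \<infinity>" "h \<infinity> \<le> g (cut n)" "i < n"
  shows "g (cut i) < g (cut (Suc i))"
proof (rule ccontr)
  assume "\<not> g (cut i) < g (cut (Suc i))"
  then have eq: "g (cut (Suc i)) = g (cut i)" using g_mono[OF cut_le_Suc[of i]] by simp
  \<comment> \<open>The level stays put, so level \<open>n\<close> would be below the top.\<close>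
  have "g (cut (i + k)) = g (cut i)" for k
  proof (induction k)
    case (Suc k)
    then show ?case using eq by simp
  qed simp
  from this[of "n - i"] assms show False by simp
qed

text \<open>The intervals between consecutive cuts just fail to be forced-max, since \<open>h (cut (Suc i))\<close> equals
  \<open>g (cut i)\<close>. Working backwards from \<open>y\<close>, each cut is replaced by a slightly later point \<open>z\<close>: there
  \<open>h\<close> already exceeds the previous level, while by continuity \<open>g z\<close> is still below the value of \<open>h\<close> at
  the right endpoint chosen before.\<close>

lemma disjoint_intervals_if_cut_less:
  assumes "g (cut i) < h y"
  shows "\<exists>A. finite A \<and> card A = Suc i \<and> (\<forall>(u, v)\<in>A. g u < h v \<and> v \<le> y) \<and>
    disjoint_family_on (\<lambda>(u, v). einterval u v) A"
  using assms
proof (induction i arbitrary: y)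
  case 0
  then show ?case by (intro exI[of _ "{(-\<infinity>, y)}"]) (auto simp: disjoint_family_on_def)
next
  case (Suc i)
  have "cut (Suc i) < \<infinity>"
    using Suc.prems h_mono[of y \<infinity>] h_PInf by (cases "cut (Suc i)") auto
  then obtain z where z: "cut (Suc i) < z" "g z < h y"
    using continuous_ereal_less_right[OF g_cont _ Suc.prems] by blast
  from z(1) obtain w where "g (cut i) < h w" "w < z" by (auto simp: Inf_less_iff)
  then have "g (cut i) < h z" using h_mono[of w z] by (meson less_imp_le order_less_le_trans)
  from Suc.IH[OF this] obtain A where A: "finite A" "card A = Suc i"
      "\<And>u v. (u, v) \<in> A \<Longrightarrow> g u < h v \<and> v \<le> z"
      "disjoint_family_on (\<lambda>(u, v). einterval u v) A"
    by blast
  have "z < y" using z(2) by (rule less_if_g_less_h)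
  have new: "(z, y) \<notin> A" using A(3)[of z y] \<open>z < y\<close> by auto
  have "einterval z y \<inter> (\<Union>(u, v)\<in>A. einterval u v) = {}"
    using A(3) by (fastforce simp: einterval_iff)
  then have "disjoint_family_on (\<lambda>(u, v). einterval u v) (insert (z, y) A)"
    using A(4) new by (simp add: disjoint_family_on_insert)
  then show ?case
    using A(1,2) new z(2) A(3)[THEN conjunct1] order.trans[OF A(3)[THEN conjunct2] less_imp_le[OF \<open>z < y\<close>]]
    by (intro exI[of _ "insert (z, y) A"]) auto
qed

end

text \<open>Breakpoints that exhaust the window: the last level equals the final common value of \<open>g\<close> and \<open>h\<close>,
  as follows from \<open>h_step\<close> for \<open>i = n\<close>.\<close>

locale window_partition = sliding_window +
  fixes p :: "nat \<Rightarrow> ereal" and n :: nat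
  assumes p_0: "p 0 = -\<infinity>" and p_last: "p (Suc n) = \<infinity>"
    and p_step: "i \<le> n \<Longrightarrow> p i \<le> p (Suc i)"
    and h_step: "i \<le> n \<Longrightarrow> h (p (Suc i)) = g (p i)"
    and g_step: "i < n \<Longrightarrow> g (p i) < g (p (Suc i))"
begin

text \<open>The length of the part of the window below the level \<open>g (p i)\<close>.\<close>

definition below :: "nat \<Rightarrow> ereal \<Rightarrow> real" where
  "below i x = min (g x) (g (p i)) - min (h x) (g (p i))"

text \<open>The length of the part of the window between the levels \<open>g (p (i - 1))\<close> and \<open>g (p i)\<close>. Written as a
  difference, it makes the sum over \<open>i\<close> telescope.\<close>

definition slice :: "nat \<Rightarrow> ereal \<Rightarrow> real" where
  "slice i x = below i x - below (i - 1) x"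

lemma sum_slice: "(\<Sum>i=1..n. slice i x) = g x - h x"
proof -
  have "(\<Sum>i=1..m. slice i x) = below m x - below 0 x" for m
    by (induction m) (auto simp: slice_def)
  moreover have "below 0 x = 0"
    using g_nonneg h_nonneg by (simp add: below_def p_0 g_MInf)
  moreover have "g (p n) = g \<infinity>"
    using h_step[of n] p_last h_PInf by simp
  then have "below n x = g x - h x"
    using g_mono[of x \<infinity>] h_mono[of x \<infinity>] h_PInf by (simp add: below_def)
  ultimately show ?thesis by simp
qed

context
  fixes i assumes i: "i \<in> {1..n}"
begin

lemma h_peak: "h (p i) = g (p (i - 1))"
  using h_step[of "i - 1"] i by (cases i) simp_all

lemma h_end: "h (p (i + 1)) = g (p i)"
  using h_step[of i] i by simp

lemma g_peak: "g (p (i - 1)) < g (p i)"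
  using g_step[of "i - 1"] i by (cases i) simp_all

text \<open>Before the peak the lower end of the window is still below the slab, so only the upper end
  matters; after the peak, only the lower end does. The maxima account for the times at which the
  window has not yet reached the slab or has already left it.\<close>

lemma slice_left:
  assumes "x \<le> p i"
  shows "slice i x = max 0 (g x - g (p (i - 1)))"
  using g_mono[OF assms] h_mono[OF assms] h_peak g_peak h_le_g[of x]
  by (auto simp: slice_def below_def)

lemma slice_right:
  assumes "p i \<le> x"
  shows "slice i x = max 0 (h (p (i + 1)) - h x)"
  using g_mono[OF assms] h_mono[OF assms] h_peak h_end g_peak h_le_g[of x]
  by (auto simp: slice_def below_def)

lemma p_order: "p (i - 1) \<le> p i" "p i \<le> p (i + 1)"
  using p_step[of "i - 1"] p_step[of i] i by (cases i; simp)+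

lemma slice_cases:
  "x \<le> p (i - 1) \<Longrightarrow> slice i x = 0"
  "p (i - 1) \<le> x \<Longrightarrow> x \<le> p i \<Longrightarrow> slice i x = g x - g (p (i - 1))"
  "p i \<le> x \<Longrightarrow> x \<le> p (i + 1) \<Longrightarrow> slice i x = h (p (i + 1)) - h x"
  "p (i + 1) \<le> x \<Longrightarrow> slice i x = 0"
proof -
  assume "x \<le> p (i - 1)"
  with p_order show "slice i x = 0" using slice_left[of x] g_mono[of x "p (i - 1)"] by auto
next
  assume "p (i - 1) \<le> x" "x \<le> p i"
  then show "slice i x = g x - g (p (i - 1))" using slice_left[of x] g_mono[of "p (i - 1)" x] by auto
next
  assume "p i \<le> x" "x \<le> p (i + 1)"
  then show "slice i x = h (p (i + 1)) - h x" using slice_right[of x] h_mono[of x "p (i + 1)"] by auto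
next
  assume "p (i + 1) \<le> x"
  with p_order show "slice i x = 0" using slice_right[of x] h_mono[of "p (i + 1)" x] by auto
qed

text \<open>The peak is a real number since \<open>h\<close> and \<open>g\<close> take different values there, whereas \<open>g\<close> and \<open>h\<close> agree at
  both infinite points.\<close>

lemma unimodal_slice: "unimodal (\<lambda>t. slice i (ereal t))"
proof -
  have "p i \<noteq> \<infinity>" using h_peak g_peak g_mono[of "p i" \<infinity>] h_PInf by auto
  moreover have "p i \<noteq> -\<infinity>" using g_peak g_nonneg[of "p (i - 1)"] g_MInf by auto
  ultimately obtain r where r: "p i = ereal r" by (cases "p i") auto
  have left: "slice i (ereal t) = max 0 (g (ereal t) - g (p (i - 1)))" if "t \<le> r" for t
    using slice_left[of "ereal t"] that r by simp
  have right: "slice i (ereal t) = max 0 (h (p (i + 1)) - h (ereal t))" if "r \<le> t" for t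
    using slice_right[of "ereal t"] that r by simp
  show ?thesis
  proof (rule unimodalI_peak[of _ r])
    have "continuous_on UNIV (\<lambda>t. g (ereal t))" "continuous_on UNIV (\<lambda>t. h (ereal t))"
      by (auto intro!: continuous_on_compose2[OF g_cont] continuous_on_compose2[OF h_cont]
          continuous_on_ereal)
    then show "continuous_on UNIV (\<lambda>t. slice i (ereal t))"
      unfolding slice_def below_def by (intro continuous_on_diff continuous_on_min continuous_on_const)
    show "0 \<le> slice i (ereal t)" for t
      using left[of t] right[of t] by (cases "t \<le> r") auto
    show "0 < slice i (ereal r)" using left[of r] g_peak r by simp
    show "slice i (ereal s) \<le> slice i (ereal t)" if "s \<le> t" "t \<le> r" for s t
      using left[of s] left[of t] that g_mono[of "ereal s" "ereal t"] by auto
    show "slice i (ereal t) \<le> slice i (ereal s)" if "r \<le> s" "s \<le> t" for s t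
      using right[of s] right[of t] that h_mono[of "ereal s" "ereal t"] by auto
  qed
qed

end
end

section \<open>The greedy decomposition\<close>

locale compactly_supported_bv = continuous_bv +
  assumes nonneg: "0 \<le> f x" and compact_support: "compact (closure {x. f x \<noteq> 0})"
begin

lemma cum_pos_minus_cum_neg: "cum_pos f x - cum_neg f x = extend0 f x"
proof -
  have "bounded {x. f x \<noteq> 0}"
    by (rule bounded_subset[OF compact_imp_bounded[OF compact_support] closure_subset])
  then obtain b where b: "\<And>t. f t \<noteq> 0 \<Longrightarrow> \<bar>t\<bar> \<le> b"
    unfolding bounded_iff by auto
  have supp: "-b \<le> t \<and> t \<le> b" if "f t \<noteq> 0" for t
    using b[OF that] by linarith
  interpret neg: continuous_bv "\<lambda>t. - f t" by (rule continuous_bv_uminus)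
  have "cum_neg (\<lambda>t. - f t) x \<le> cum_neg f x + extend0 f x"
    using supp by (rule cum_neg_uminus_le)
  moreover have "cum_neg f x \<le> cum_neg (\<lambda>t. - f t) x + extend0 (\<lambda>t. - f t) x"
    using neg.cum_neg_uminus_le[of "-b" b x] supp by simp
  moreover have "extend0 (\<lambda>t. - f t) x = - extend0 f x" by (simp add: extend0_def)
  ultimately show ?thesis by (simp add: cum_pos_eq)
qed

lemma extend0_nonneg: "0 \<le> extend0 f x"
  by (simp add: extend0_def nonneg)

sublocale sliding_window "cum_pos f" "cum_neg f"
proof -
  interpret neg: continuous_bv "\<lambda>t. - f t" by (rule continuous_bv_uminus)
  show "sliding_window (cum_pos f) (cum_neg f)"
  proof
    show "cum_neg f \<infinity> = cum_pos f \<infinity>"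
      using cum_pos_minus_cum_neg[of \<infinity>] by (simp add: extend0_def)
    show "cum_neg f x \<le> cum_pos f x" for x
      using cum_pos_minus_cum_neg[of x] extend0_nonneg[of x] by simp
    show "cum_pos f x \<le> cum_pos f y" if "x \<le> y" for x y
      unfolding cum_pos_eq using that by (rule neg.cum_neg_mono)
    show "continuous_on UNIV (cum_pos f)"
      unfolding cum_pos_eq by (rule neg.continuous_cum_neg)
    show "cum_pos f (-\<infinity>) = 0" unfolding cum_pos_eq by (rule neg.cum_neg_MInf)
  qed (rule cum_neg_mono continuous_cum_neg cum_neg_MInf; assumption)+
qed

text \<open>The dictionary between variations and the window: with \<open>f x = g x - h x\<close>, the condition
  \<open>h y - h x > f x\<close> reads \<open>h y > g x\<close>. It also holds for \<open>y \<le> x\<close>, where both sides fail; the infimum that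
  defines a breakpoint ranges over all \<open>y\<close>.\<close>

lemma neg_var_exceeds_iff:
  "ennreal (extend0 f x) < neg_var f (einterval x y) \<longleftrightarrow> cum_pos f x < cum_neg f y"
proof (cases "x \<le> y")
  case True
  then show ?thesis
    using neg_var_einterval[of x y] cum_pos_minus_cum_neg[of x] extend0_nonneg[of x]
    by (auto simp: ennreal_less_iff)
next
  case False
  then have "einterval x y = {}" by (force simp: einterval_iff)
  moreover have "\<not> cum_pos f x < cum_neg f y" using False less_if_g_less_h[of x y] by auto
  ultimately show ?thesis by simp
qed

lemma forced_max_iff: "forced_max f x y \<longleftrightarrow> cum_pos f x < cum_neg f y"
  using less_if_g_less_h[of x y] neg_var_exceeds_iff[of x y] by (auto simp: forced_max_def)

lemma breakpoint_eq_cut: "i \<le> n \<Longrightarrow> breakpoint f n i = cut i"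
  by (induction i) (simp_all add: neg_var_exceeds_iff)

lemma Suc_le_max_forced:
  assumes "cum_pos f (cut i) < cum_neg f \<infinity>"
  shows "enat (Suc i) \<le> max_forced f"
proof -
  obtain A where A: "finite A" "card A = Suc i" "\<forall>(x, y)\<in>A. cum_pos f x < cum_neg f y \<and> y \<le> \<infinity>"
      "disjoint_family_on (\<lambda>(x, y). einterval x y) A"
    using disjoint_intervals_if_cut_less[OF assms] by blast
  then have forced: "\<forall>(x, y)\<in>A. forced_max f x y" by (auto simp: forced_max_iff)
  show ?thesis
    unfolding max_forced_def A(2)[symmetric]
    by (intro Sup_upper CollectI exI[of _ A] conjI refl A(1,4) forced)
qed

lemma unimodal_decomposition_piece:
  assumes stop: "cum_neg f \<infinity> \<le> cum_pos f (cut n)"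
    and go: "\<And>i. i < n \<Longrightarrow> cum_pos f (cut i) < cum_neg f \<infinity>"
  shows "pieces_agree f n" "unimodal_decomposition f n (piece f n)"
proof -
  interpret window_partition "cum_pos f" "cum_neg f" "breakpoint f n" n
  proof
    show "breakpoint f n i \<le> breakpoint f n (Suc i)" if "i \<le> n" for i
      using that cut_le_Suc[of i] by (cases "i = n") (simp_all del: cut.simps breakpoint.simps add: breakpoint_eq_cut, simp)
    show "cum_neg f (breakpoint f n (Suc i)) = cum_pos f (breakpoint f n i)" if "i \<le> n" for i
    proof (cases "i = n")
      case True
      have "cum_pos f (cut n) = cum_neg f \<infinity>" using stop g_mono[of "cut n" \<infinity>] h_PInf by simp
      with True show ?thesis by (simp add: breakpoint_eq_cut)
    next
      case False
      with that h_cut[OF go[of i]] show ?thesis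
        by (simp del: cut.simps breakpoint.simps add: breakpoint_eq_cut)
    qed
    show "cum_pos f (breakpoint f n i) < cum_pos f (breakpoint f n (Suc i))" if "i < n" for i
      using g_cut_strict[OF go[OF that] stop that] that
      by (simp del: cut.simps breakpoint.simps add: breakpoint_eq_cut)
  qed simp_all
  have piece_eq: "piece f n i x = slice i (ereal x)" if "i \<in> {1..n}" for i x
    using slice_cases[OF that, of "ereal x"] by (auto simp: piece_def not_le)
  show "pieces_agree f n"
    unfolding pieces_agree_def using piece_eq slice_cases by metis
  show "unimodal_decomposition f n (piece f n)"
    unfolding unimodal_decomposition_def
  proof (intro conjI ballI allI)
    fix i assume i: "i \<in> {1..n}"
    then have "piece f n i = (\<lambda>t. slice i (ereal t))" by (simp add: piece_eq fun_eq_iff)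
    with unimodal_slice[OF i] show "unimodal (piece f n i)" by simp
  next
    fix x
    have "(\<Sum>i=1..n. piece f n i x) = (\<Sum>i=1..n. slice i (ereal x))"
      by (intro sum.cong) (simp_all add: piece_eq)
    then show "f x = (\<Sum>i=1..n. piece f n i x)"
      using sum_slice[of "ereal x"] cum_pos_minus_cum_neg[of "ereal x"] by (simp add: extend0_def)
  qed
qed

end

theorem theorem3p4:
  fixes f :: "real \<Rightarrow> real"
  assumes "continuous_on UNIV f"
    and "\<forall>x. 0 \<le> f x"
    and "compact (closure {x. f x \<noteq> 0})"
    and "total_var f UNIV < \<infinity>"
  shows "ucat f = max_forced f \<and>
    (\<forall>n. max_forced f = enat n \<longrightarrow>
       pieces_agree f n \<and> unimodal_decomposition f n (piece f n) \<and> ucat f = enat n)"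
proof -
  interpret compactly_supported_bv f
    using assms by unfold_locales auto
  show ?thesis
  proof (cases "\<exists>n. cum_neg f \<infinity> \<le> cum_pos f (cut n)")
    case True
    define n where "n = (LEAST n. cum_neg f \<infinity> \<le> cum_pos f (cut n))"
    have stop: "cum_neg f \<infinity> \<le> cum_pos f (cut n)"
      unfolding n_def using True by (rule LeastI_ex)
    have go: "cum_pos f (cut i) < cum_neg f \<infinity>" if "i < n" for i
      using that[unfolded n_def, THEN not_less_Least] by (simp add: not_le)
    note dec = unimodal_decomposition_piece[OF stop go]
    \<comment> \<open>The chain \<open>n \<le> max_forced f \<le> ucat f \<le> n\<close> also identifies \<open>n\<close> with any value of \<open>max_forced f\<close>.\<close>
    have "ucat f \<le> enat n" unfolding ucat_def using dec(2) by (intro Inf_lower) blast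
    moreover have "enat n \<le> max_forced f"
    proof (cases n)
      case (Suc m)
      then show ?thesis using Suc_le_max_forced[OF go[of m]] by simp
    qed (simp add: zero_enat_def[symmetric])
    ultimately have "ucat f = enat n" "max_forced f = enat n"
      using max_forced_le_ucat[of f] by auto
    with dec show ?thesis by auto
  next
    case False
    then have "enat (Suc i) \<le> max_forced f" for i
      using Suc_le_max_forced[of i] by (auto simp: not_le)
    then have "max_forced f = \<infinity>"
      by (metis enat_ord_simps(1) not_enat_eq not_less_eq_eq order_refl)
    with max_forced_le_ucat[of f] show ?thesis by simp
  qed
qed

end
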